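(* For every complex $q$ with $|q|<1$, $$\sum_{n,l=0}^\infty\frac{q^{n^2+l^2}}{(q;q)_{n+l}(q;q)_n(q;q)_l}=\frac{1}{(q;q)_\infty}\prod_{\substack{m\ge1\\ m\not\equiv0,\pm3\ (\mathrm{mod}\ 7)}}\frac{1}{1-q^m}.$$
   Context: Notation: $(x;q)_n=\prod_{j=0}^{n-1}(1-xq^j)$ for integers $n\ge0$, and $(x;q)_\infty=\prod_{j\ge0}(1-xq^j)$. *)

theory Defs
  imports "HOL-Analysis.Analysis" "HOL-Number_Theory.Cong"
begin

definition qpoch :: "complex \<Rightarrow> complex \<Rightarrow> nat \<Rightarrow> complex" where
  "qpoch x q n = (\<Prod>j<n. 1 - x * q ^ j)"

definition qpoch_inf :: "complex \<Rightarrow> complex \<Rightarrow> complex" where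
  "qpoch_inf x q = (\<Prod>j. 1 - x * q ^ j)"

end

(*
  Write P n = (q;q)_n.  Let S l be the sum of q^(k^2) / (P k * P (l - k)) over k <= l.
  Summing over n first, Heine's transformation gives
  sum_n q^(n^2) / (P n * P (n + l)) = P l * S l / (q;q)_oo;
  the transformed series terminates.  This is proved by induction on l, for the more general
  exponents n(n + c), starting from Cauchy's identity sum_n q^(n(n+c)) / (P n * P (n + c)) = 1 / (q;q)_oo.
  The double sum therefore equals 1 / (q;q)_oo times the sum of q^(l^2) * S l over l, which is the
  Andrews-Gordon series for the modulus 7.  Iterating the Bailey lemma on the unit Bailey pair turns
  that series into a theta series, which the Jacobi triple product in base q^7 evaluates.
*)
theory Submission
  imports Defs
begin

subsection \<open>The q-binomial theorem and the q-Chu-Vandermonde sum\<close>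

lemma qpoch_0 [simp]: "qpoch x q 0 = 1"
  by (simp add: qpoch_def)

lemma qpoch_Suc: "qpoch x q (Suc n) = qpoch x q n * (1 - x * q ^ n)"
  by (simp add: qpoch_def)

lemma one_minus_power_nonzero:
  fixes q :: complex
  assumes "norm q < 1" "0 < n"
  shows "1 - q ^ n \<noteq> 0"
proof
  assume "1 - q ^ n = 0"
  then have "norm q ^ n = 1" by (metis eq_iff_diff_eq_0 norm_one norm_power)
  moreover have "norm q ^ n < 1" using assms by (simp add: power_less_one_iff)
  ultimately show False by simp
qed

lemma qpoch_self_nonzero: "norm q < 1 \<Longrightarrow> qpoch q q n \<noteq> 0"
  using one_minus_power_nonzero[of q "Suc _"] by (auto simp: qpoch_def)

text \<open>The Gaussian binomial coefficient. The value 0 above the diagonal makes the q-Pascal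
  rules hold at the boundary without side conditions.\<close>

definition qbin :: "complex \<Rightarrow> nat \<Rightarrow> nat \<Rightarrow> complex" where
  "qbin q m s = (if s \<le> m then qpoch q q m / (qpoch q q s * qpoch q q (m - s)) else 0)"

lemma qbin_0_right: "norm q < 1 \<Longrightarrow> qbin q m 0 = 1"
  by (simp add: qbin_def qpoch_self_nonzero)

lemma qbin_eq_0: "m < s \<Longrightarrow> qbin q m s = 0"
  by (simp add: qbin_def)

text \<open>The two q-Pascal rules; the symmetry of the Gaussian binomial exchanges them. Only
  \<open>s < m\<close> needs a computation.\<close>

lemma qbin_Suc_Suc:
  assumes q: "norm q < 1"
  shows "qbin q (Suc m) (Suc s) = qbin q m s + q ^ Suc s * qbin q m (Suc s)" (is ?A)
    and "qbin q (Suc m) (Suc s) = qbin q m (Suc s) + q ^ (m - s) * qbin q m s" (is ?B)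
proof -
  have "?A \<and> ?B"
  proof (cases "s < m")
    case True
    then obtain t where m: "m = Suc (s + t)" using less_imp_Suc_add by blast
    have d: "m - s = Suc t" "m - Suc s = t" "Suc m - Suc s = Suc t" using m by auto
    have nz: "qpoch q q s \<noteq> 0" "qpoch q q t \<noteq> 0" "1 - q * q ^ s \<noteq> 0" "1 - q * q ^ t \<noteq> 0"
      using qpoch_self_nonzero[OF q] one_minus_power_nonzero[OF q, of "Suc _"] by auto
    have e: "q ^ m = q * q ^ s * q ^ t" by (simp add: m power_add)
    show ?thesis using nz True
      by (simp add: qbin_def d qpoch_Suc e divide_simps) (simp add: algebra_simps)
  next
    case False
    then show ?thesis using qpoch_self_nonzero[OF q] by (auto simp: qbin_def)
  qed
  then show ?A ?B by blast+
qed

text \<open>The q-Pascal rules in summed form: a sum over row \<open>m + 1\<close> becomes a sum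
  over row \<open>m\<close> with a changed weight. Inductions on the row then only have to simplify
  the new weight.\<close>

lemma qbin_sum_Suc:
  assumes q: "norm q < 1"
  shows "(\<Sum>s\<le>Suc m. qbin q (Suc m) s * f s) =
           (\<Sum>s\<le>m. qbin q m s * (q ^ s * f s + f (Suc s)))" (is ?A)
    and "(\<Sum>s\<le>Suc m. qbin q (Suc m) s * f s) =
           (\<Sum>s\<le>m. qbin q m s * (f s + q ^ (m - s) * f (Suc s)))" (is ?B)
proof -
  \<comment> \<open>Splits off the term at 0; the extra top term contains
    \<open>qbin q m (Suc m) = 0\<close>.\<close>
  have *: "(\<Sum>s\<le>m. qbin q m s * g s) = g 0 + (\<Sum>s\<le>m. qbin q m (Suc s) * g (Suc s))" for g
  proof -
    have "(\<Sum>s\<le>m. qbin q m s * g s) = (\<Sum>s\<le>Suc m. qbin q m s * g s)"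
      by (simp add: qbin_eq_0)
    then show ?thesis by (simp only: sum.atMost_Suc_shift) (simp add: qbin_0_right q)
  qed
  show ?A
    by (simp only: sum.atMost_Suc_shift qbin_Suc_Suc(1)[OF q] qbin_0_right[OF q] distrib_left
        sum.distrib mult.assoc[symmetric] *[of "\<lambda>s. q ^ s * f s", unfolded mult.assoc[symmetric]])
      (simp add: algebra_simps sum.distrib)
  show ?B
    by (simp only: sum.atMost_Suc_shift qbin_Suc_Suc(2)[OF q] qbin_0_right[OF q] distrib_left
        sum.distrib *[of f])
      (simp add: algebra_simps sum.distrib)
qed

text \<open>By the first q-Pascal rule, the terms at \<open>s\<close> and \<open>s + 1\<close> merge
  into the summand at \<open>s\<close> with \<open>a + 1\<close> in place of \<open>a\<close>. So
  row \<open>m + 1\<close> at \<open>a\<close> reduces to row \<open>m\<close> at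
  \<open>a + 1\<close>, which is why \<open>a\<close> varies in the induction.\<close>

lemma q_Chu_Vandermonde:
  assumes q: "norm q < 1"
  shows "(\<Sum>s\<le>m. qbin q m s * (q ^ (s * (s + a)) / qpoch q q (s + a))) = 1 / qpoch q q (m + a)"
proof (induction m arbitrary: a)
  case 0
  then show ?case by (simp add: qbin_0_right q)
next
  case (Suc m)
  have "q ^ s * (q ^ (s * (s + a)) / qpoch q q (s + a)) +
          q ^ (Suc s * (Suc s + a)) / qpoch q q (Suc s + a) =
        q ^ (s * (s + Suc a)) / qpoch q q (s + Suc a)" for s
  proof -
    have "q ^ (Suc s * (Suc s + a)) = q ^ (s * (s + Suc a)) * (q * q ^ (s + a))"
      by (simp add: algebra_simps flip: power_add)
    moreover have "q ^ s * q ^ (s * (s + a)) = q ^ (s * (s + Suc a))"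
      by (simp add: algebra_simps flip: power_add)
    moreover have "qpoch q q (s + a) \<noteq> 0" "1 - q * q ^ (s + a) \<noteq> 0"
      using qpoch_self_nonzero[OF q] one_minus_power_nonzero[OF q, of "Suc (s + a)"] by auto
    ultimately show ?thesis
      by (simp add: qpoch_Suc divide_simps del: power_Suc mult_Suc mult_Suc_right)
         (simp add: algebra_simps)
  qed
  then show ?case using Suc.IH[of "Suc a"]
    by (simp only: qbin_sum_Suc(1)[OF q] add_Suc_shift)
qed

text \<open>By the second q-Pascal rule, neighbouring terms combine with the factor
  \<open>1 - x * q ^ N\<close>, which does not depend on \<open>k\<close> and leaves the
  sum.\<close>

lemma q_binomial_theorem:
  assumes q: "norm q < 1"
  shows "(\<Sum>k\<le>N. qbin q N k * ((- x) ^ k * q ^ (k choose 2))) = qpoch x q N"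
proof (induction N)
  case 0
  then show ?case by (simp add: qbin_0_right q numeral_2_eq_2)
next
  case (Suc N)
  have "(- x) ^ k * q ^ (k choose 2) + q ^ (N - k) * ((- x) ^ Suc k * q ^ (Suc k choose 2)) =
        (- x) ^ k * q ^ (k choose 2) * (1 - x * q ^ N)" if "k \<le> N" for k
  proof -
    have "q ^ N = q ^ (N - k) * q ^ k" using that by (simp flip: power_add)
    then show ?thesis by (simp add: numeral_2_eq_2 power_add algebra_simps)
  qed
  then show ?case 
    by (simp add: qbin_sum_Suc(2)[OF q] qpoch_Suc sum_distrib_right mult.assoc flip: Suc.IH
             del: sum.atMost_Suc power_Suc)
qed

subsection \<open>The finite Jacobi triple product and Bailey chain\<close>

lemma sum_fold_symmetric:
  fixes f :: "nat \<Rightarrow> 'a :: comm_monoid_add"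
  shows "(\<Sum>k\<le>2 * n. f k) = (\<Sum>j\<le>n. if j = 0 then f n else f (n + j) + f (n - j))"
proof -
  have "{..2 * n} = {..<n} \<union> {n..2*n}" by auto
  then have "(\<Sum>k\<le>2 * n. f k) = (\<Sum>k<n. f k) + (\<Sum>k=n..2*n. f k)"
    by (simp add: sum.union_disjoint[of "{..<n}" "{n..2 * n}"] disjoint_iff)
  also have "(\<Sum>k=n..2*n. f k) = (\<Sum>j\<le>n. f (n + j))"
    by (rule sum.reindex_bij_witness[where i = "\<lambda>j. n + j" and j = "\<lambda>k. k - n"]) auto
  also have "\<dots> = f n + (\<Sum>j=1..n. f (n + j))"
    by (simp add: atMost_atLeast0 sum.atLeast_Suc_atMost)
  also have "(\<Sum>k<n. f k) = (\<Sum>j=1..n. f (n - j))"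
    by (rule sum.reindex_bij_witness[where i = "\<lambda>j. n - j" and j = "\<lambda>k. n - k"]) auto
  finally have "(\<Sum>k\<le>2 * n. f k) = f n + (\<Sum>j=1..n. f (n + j) + f (n - j))"
    by (simp add: sum.distrib algebra_simps)
  also have "\<dots> = (\<Sum>j\<le>n. if j = 0 then f n else f (n + j) + f (n - j))"
    by (simp add: atMost_atLeast0 sum.atLeast_Suc_atMost)
  finally show ?thesis .
qed

text \<open>
  The bilateral theta series \<open>\<Sum>j\<in>\<int>. (-1)^j q^(j(j-1)/2) z^j\<close>, folded at \<open>j = \<plusminus>k\<close> using \<open>w = q/z\<close>;
  the folding keeps all exponents natural.
\<close>
definition theta_coeff :: "complex \<Rightarrow> complex \<Rightarrow> complex \<Rightarrow> nat \<Rightarrow> complex" where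
  "theta_coeff q z w k = (if k = 0 then 1 else (- 1) ^ k * q ^ (k choose 2) * (z ^ k + w ^ k))"

text \<open>The upper \<open>n\<close> factors form \<open>qpoch z q n\<close>. Each lower factor
  \<open>1 - z / q ^ (j + 1)\<close> becomes \<open>- z * (1 - w * q ^ j)\<close> after
  multiplication by \<open>q ^ (j + 1)\<close>, since \<open>z * w = q\<close>; these powers
  multiply to \<open>q ^ (Suc n choose 2)\<close>.\<close>

lemma qpoch_shift_double:
  assumes "q \<noteq> 0" "z * w = q"
  shows "qpoch (z / q ^ n) q (2 * n) * q ^ (Suc n choose 2) = (- z) ^ n * (qpoch z q n * qpoch w q n)"
proof -
  have "(\<Prod>i<n + m. g i) = (\<Prod>i<n. g i) * (\<Prod>i<m. g (n + i))" for g :: "nat \<Rightarrow> complex" and m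
    by (induction m) (simp_all add: mult.assoc)
  then have "qpoch (z / q ^ n) q (2 * n) = (\<Prod>i<n. 1 - z / q ^ n * q ^ i) * (\<Prod>i<n. 1 - z / q ^ n * q ^ (n + i))"
    by (simp add: qpoch_def mult_2)
  also have "(\<Prod>i<n. 1 - z / q ^ n * q ^ (n + i)) = qpoch z q n"
    using assms by (simp add: qpoch_def power_add)
  also have "(\<Prod>i<n. 1 - z / q ^ n * q ^ i) = (\<Prod>j<n. 1 - z / q ^ Suc j)"
    using assms by (intro prod.reindex_bij_witness[where i = "\<lambda>j. n - Suc j" and j = "\<lambda>k. n - Suc k"])
       (auto simp: power_diff field_simps simp flip: power_add)
  finally have 1: "qpoch (z / q ^ n) q (2 * n) = (\<Prod>j<n. 1 - z / q ^ Suc j) * qpoch z q n" .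
  have "(\<Prod>j<n. 1 - z / q ^ Suc j) * q ^ (Suc n choose 2) = (- z) ^ n * qpoch w q n"
  proof (induction n)
    case (Suc n)
    have e: "(1 - z / q ^ Suc n) * q ^ Suc n = - z * (1 - w * q ^ n)"
      using assms by (simp add: field_simps)
    have "q ^ (Suc (Suc n) choose 2) = q ^ Suc n * q ^ (Suc n choose 2)"
      by (simp add: numeral_2_eq_2 power_add)
    then have "(\<Prod>j<Suc n. 1 - z / q ^ Suc j) * q ^ (Suc (Suc n) choose 2) =
        ((\<Prod>j<n. 1 - z / q ^ Suc j) * q ^ (Suc n choose 2)) * ((1 - z / q ^ Suc n) * q ^ Suc n)"
      by (simp only: prod.lessThan_Suc mult_ac)
    also have "(1 - z / q ^ Suc n) * q ^ Suc n = - z * (1 - w * q ^ n)" by (fact e)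
    finally show ?case
      unfolding Suc.IH by (simp add: qpoch_Suc)
  qed (simp add: numeral_2_eq_2)
  from arg_cong[OF this, of "\<lambda>t. t * qpoch z q n"] show ?thesis
    unfolding 1 by (simp only: mult_ac)
qed

text \<open>In Bailey's terms, \<open>theta_coeff\<close> is the alpha and the right-hand side the
  beta of a Bailey pair relative to 1. It serves twice: at \<open>z = 1\<close> to start the Bailey
  chain, and in base \<open>q ^ 7\<close> to evaluate the final theta series.\<close>

lemma finite_Jacobi_triple_product:
  assumes q: "norm q < 1" "q \<noteq> 0" and zw: "z * w = q"
  shows "(\<Sum>k\<le>n. theta_coeff q z w k / (qpoch q q (n - k) * qpoch q q (n + k))) =
         qpoch z q n * qpoch w q n / qpoch q q (2 * n)"
proof -
  define x where "x = z / q ^ n"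
  define C where "C = q ^ (Suc n choose 2) / (- z) ^ n"
  define f where "f k = (- x) ^ k * q ^ (k choose 2)" for k
  have [simp]: "z \<noteq> 0" "w \<noteq> 0" using q zw by auto
  (* The q-binomial theorem for (z/q^n; q)_(2n), recentred at its middle term k = n. *)
  have up: "C * f (n + j) = (- 1) ^ j * q ^ (j choose 2) * z ^ j" for j
  proof -
    have "(Suc n choose 2) + (n + j choose 2) = n * (n + j) + (j choose 2)"
      by (induction n) (simp_all add: numeral_2_eq_2)
    then have "q ^ (Suc n choose 2) * q ^ (n + j choose 2) = (q ^ n) ^ (n + j) * q ^ (j choose 2)"
      by (metis power_add power_mult)
    moreover have "(- x) ^ (n + j) = (- 1) ^ j * (- z) ^ n * z ^ j / (q ^ n) ^ (n + j)"
      by (simp add: x_def power_divide power_add power_minus[of z] power_minus[of "z / _"])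
    moreover have "a / Z * (s * Z * t / X * b) = s * c * t"
      if "a * b = X * c" "Z \<noteq> 0" "X \<noteq> 0" for a b c s t X Z :: complex
      using that by (simp add: divide_simps)
    ultimately show ?thesis using q unfolding C_def f_def by simp
  qed
  \<comment> \<open>Left of the middle, \<open>z\<close> has exponent \<open>- j\<close>; the
    surplus factor \<open>q ^ j = z ^ j * w ^ j\<close> turns this into
    \<open>w ^ j\<close>.\<close>
  have down: "C * f (n - j) = (- 1) ^ j * q ^ (j choose 2) * w ^ j" if "j \<le> n" for j
  proof -
    define m where "m = n - j"
    have n: "n = m + j" using that by (simp add: m_def)
    have "(Suc n choose 2) + (m choose 2) = n * m + j + (j choose 2)" unfolding n
      by (induction m) (simp_all add: numeral_2_eq_2)
    then have "q ^ (Suc n choose 2) * q ^ (m choose 2) = (q ^ n) ^ m * q ^ j * q ^ (j choose 2)"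
      by (metis power_add power_mult)
    moreover have "(- x) ^ m = (- z) ^ m / (q ^ n) ^ m"
      by (simp add: x_def power_divide power_minus[of z] power_minus[of "z / _"])
    moreover have "q ^ j = z ^ j * w ^ j" by (simp flip: zw add: power_mult_distrib)
    moreover have "(- z) ^ n = (- 1) ^ j * (- z) ^ m * z ^ j"
      by (simp add: n power_add power_minus[of z j])
    moreover have "n - j = m" by (simp add: n)
    moreover have "a / (s * Z * t) * (Z / X * b) = s * c * w ^ j"
      if "a * b = X * (t * w ^ j) * c" "Z \<noteq> 0" "X \<noteq> 0" "t \<noteq> 0" "s * s = 1" for a b c s t X Z :: complex
    proof -
      have "a / (s * Z * t) * (Z / X * b) = (a * b) * (s * s) / (s * t * X)"
        using that by auto
      also have "\<dots> = s * c * w ^ j" 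
      proof -
        have "s \<noteq> 0" using that(5) by auto
        moreover have "s * c * w ^ j * s = (s * s) * (w ^ j * c)" by (simp only: mult_ac)
        ultimately show ?thesis
          unfolding that(1) using that by (simp add: divide_simps mult_ac)
      qed
      finally show ?thesis .
    qed
    ultimately show ?thesis using q unfolding C_def f_def by simp
  qed
  have "qpoch z q n * qpoch w q n = C * qpoch x q (2 * n)"
    using qpoch_shift_double[OF q(2) zw, of n] by (simp add: C_def x_def field_simps)
  also have "\<dots> = (\<Sum>k\<le>2 * n. C * (qbin q (2 * n) k * f k))"
    by (simp add: f_def sum_distrib_left flip: q_binomial_theorem[OF q(1)])
  also have "\<dots> = (\<Sum>k\<le>n. qpoch q q (2 * n) * 
        (theta_coeff q z w k / (qpoch q q (n - k) * qpoch q q (n + k))))"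
    unfolding sum_fold_symmetric
  proof (rule sum.cong, safe)
    fix k assume k: "k \<le> n"
    have "2 * n - (n + k) = n - k" "2 * n - (n - k) = n + k" using k by auto
    with k have b: "qbin q (2 * n) (n + k) = qpoch q q (2 * n) / (qpoch q q (n - k) * qpoch q q (n + k))"
      "qbin q (2 * n) (n - k) = qpoch q q (2 * n) / (qpoch q q (n - k) * qpoch q q (n + k))"
      by (auto simp: qbin_def)
    have m: "C * (a * y) = a * (C * y)" for a y by simp
    show "(if k = 0 then C * (qbin q (2 * n) n * f n)
            else C * (qbin q (2 * n) (n + k) * f (n + k)) + C * (qbin q (2 * n) (n - k) * f (n - k))) =
          qpoch q q (2 * n) * (theta_coeff q z w k / (qpoch q q (n - k) * qpoch q q (n + k)))"
      unfolding m up down[OF k] b using b up[of 0]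
      by (auto simp: theta_coeff_def add_divide_distrib algebra_simps numeral_2_eq_2)
  qed
  finally show ?thesis
    unfolding sum_distrib_left[symmetric] using qpoch_self_nonzero[OF q(1), of "2 * n"] by simp
qed

text \<open>After exchanging the summations and putting \<open>r = s + k\<close>, the identity
  \<open>(s + k)^2 = k^2 + s * (s + 2 * k)\<close> makes the inner sum a q-Chu-Vandermonde sum with
  \<open>a = 2 * k\<close>. The right-hand side has the shape of the hypothesis, with
  \<open>\<alpha> k\<close> multiplied by \<open>q\<close> to the power \<open>k^2\<close>, so the
  lemma can be iterated.\<close>

lemma Bailey_lemma:
  assumes q: "norm q < 1"
    and \<beta>: "\<And>n. \<beta> n = (\<Sum>k\<le>n. \<alpha> k / (qpoch q q (n - k) * qpoch q q (n + k)))"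
  shows "(\<Sum>r\<le>n. q ^ r\<^sup>2 * \<beta> r / qpoch q q (n - r)) =
         (\<Sum>k\<le>n. q ^ k\<^sup>2 * \<alpha> k / (qpoch q q (n - k) * qpoch q q (n + k)))"
proof -
  let ?P = "qpoch q q"
  let ?g = "\<lambda>r k. q ^ r\<^sup>2 * \<alpha> k / (?P (r - k) * ?P (r + k) * ?P (n - r))"
  have "(\<Sum>r\<le>n. q ^ r\<^sup>2 * \<beta> r / ?P (n - r)) = (\<Sum>r\<le>n. \<Sum>k\<le>r. ?g r k)"
    by (simp add: \<beta> sum_distrib_left sum_divide_distrib)
  also have "\<dots> = (\<Sum>k\<le>n. \<Sum>r=k..n. ?g r k)"
    by (simp add: sum.Sigma) (rule sum.reindex_bij_witness[where i = prod.swap and j = prod.swap]; auto)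
  also have "\<dots> = (\<Sum>k\<le>n. q ^ k\<^sup>2 * \<alpha> k / (?P (n - k) * ?P (n + k)))"
  proof (rule sum.cong[OF refl])
    fix k assume "k \<in> {..n}"
    then obtain m where n: "n = m + k" by (metis add.commute atMost_iff le_Suc_ex)
    have "(\<Sum>r=k..n. ?g r k) = (\<Sum>s\<le>m. ?g (s + k) k)"
      by (rule sum.reindex_bij_witness[where i = "\<lambda>s. s + k" and j = "\<lambda>r. r - k"]) (auto simp: n)
    also have "\<dots> = (\<Sum>s\<le>m. q ^ k\<^sup>2 * \<alpha> k / ?P m * (qbin q m s * (q ^ (s * (s + 2 * k)) / ?P (s + 2 * k))))"
    proof (rule sum.cong[OF refl])
      fix s assume s: "s \<in> {..m}"
      have "q ^ (s + k)\<^sup>2 = q ^ k\<^sup>2 * q ^ (s * (s + 2 * k))"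
        by (simp add: power2_eq_square algebra_simps mult_2_right flip: power_add)
      moreover have e: "s + k + k = s + 2 * k" "n - (s + k) = m - s" by (auto simp: n)
      ultimately show "?g (s + k) k =
        q ^ k\<^sup>2 * \<alpha> k / ?P m * (qbin q m s * (q ^ (s * (s + 2 * k)) / ?P (s + 2 * k)))"
        using s qpoch_self_nonzero[OF q] by (simp add: qbin_def e mult_ac)
    qed
    also have "\<dots> = q ^ k\<^sup>2 * \<alpha> k / ?P m * (1 / ?P (m + 2 * k))"
      by (simp only: q_Chu_Vandermonde[OF q] flip: sum_distrib_left)
    finally show "(\<Sum>r=k..n. ?g r k) = q ^ k\<^sup>2 * \<alpha> k / (?P (n - k) * ?P (n + k))"
      by (simp add: n mult_2 add.assoc)
  qed
  finally show ?thesis .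
qed

lemma finite_Andrews_Gordon_7:
  assumes q: "norm q < 1" "q \<noteq> 0"
  shows "(\<Sum>N\<le>L. q ^ N\<^sup>2 * (\<Sum>r\<le>N. q ^ r\<^sup>2 / (qpoch q q r * qpoch q q (N - r))) / qpoch q q (L - N)) =
    (\<Sum>k\<le>L. theta_coeff (q ^ 7) (q ^ 3) (q ^ 4) k / (qpoch q q (L - k) * qpoch q q (L + k)))"
proof -
  let ?P = "qpoch q q"
  (* z = 1 gives the unit Bailey pair, to which the Bailey lemma is applied three times. *)
  have "qpoch 1 q n * qpoch q q n / qpoch q q (2 * n) = of_bool (n = 0)" for n
    by (cases n) (simp_all add: qpoch_def prod.lessThan_Suc_shift del: prod.lessThan_Suc)
  then have 0: "of_bool (n = 0) = (\<Sum>k\<le>n. theta_coeff q 1 q k / (?P (n - k) * ?P (n + k)))" for n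
    using finite_Jacobi_triple_product[OF q, of 1 q n] by simp
  have "(\<Sum>r\<le>n. q ^ r\<^sup>2 * of_bool (r = 0) / ?P (n - r)) = 1 / ?P n" for n
    by (simp add: sum.atMost_shift)
  then have 1: "1 / ?P n = (\<Sum>k\<le>n. q ^ k\<^sup>2 * theta_coeff q 1 q k / (?P (n - k) * ?P (n + k)))" for n
    using Bailey_lemma[OF q(1) 0, of n] by simp
  have 2: "(\<Sum>r\<le>n. q ^ r\<^sup>2 / (?P r * ?P (n - r))) =
      (\<Sum>k\<le>n. q ^ k\<^sup>2 * (q ^ k\<^sup>2 * theta_coeff q 1 q k) / (?P (n - k) * ?P (n + k)))" for n
    using Bailey_lemma[OF q(1) 1, of n] by simp
  \<comment> \<open>The three factors gained along the chain change the base: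
    \<open>3 * k^2 + (k choose 2) = 7 * (k choose 2) + 3 * k\<close>. The pair \<open>z = 1\<close>,
    \<open>w = q\<close> thereby becomes \<open>q ^ 3\<close>, \<open>q ^ 4\<close> in base
    \<open>q ^ 7\<close>.\<close>
  have "q ^ k\<^sup>2 * (q ^ k\<^sup>2 * (q ^ k\<^sup>2 * theta_coeff q 1 q k)) = theta_coeff (q ^ 7) (q ^ 3) (q ^ 4) k" for k
  proof -
    have "3 * k\<^sup>2 + (k choose 2) = 7 * (k choose 2) + 3 * k"
      by (induction k) (simp_all add: numeral_2_eq_2 algebra_simps)
    then have "(q ^ k\<^sup>2) ^ 3 * q ^ (k choose 2) = (q ^ 7) ^ (k choose 2) * (q ^ 3) ^ k"
      unfolding power_add[symmetric] power_mult[symmetric] by (simp only: mult.commute[of "k\<^sup>2" 3])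
    moreover have "(q ^ 4) ^ k = (q ^ 3) ^ k * q ^ k"
      by (simp flip: power_mult power_add)
    ultimately show ?thesis
      by (simp add: theta_coeff_def power3_eq_cube algebra_simps)
  qed
  then show ?thesis using Bailey_lemma[OF q(1) 2, of L] by simp
qed

subsection \<open>Limits\<close>

lemma convergent_prod_qpoch:
  fixes q x :: complex
  assumes q: "norm q < 1"
  shows "convergent_prod (\<lambda>j. 1 - x * q ^ j)"
proof -
  have "summable (\<lambda>j. norm (1 - x * q ^ j - 1))"
    using q by (auto simp: norm_mult norm_power intro!: summable_mult summable_geometric)
  then show ?thesis
    by (intro abs_convergent_prod_imp_convergent_prod) (simp add: abs_convergent_prod_conv_summable)
qed

lemma qpoch_LIMSEQ:
  assumes q: "norm q < 1"
  shows "(\<lambda>n. qpoch x q n) \<longlonglongrightarrow> qpoch_inf x q"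
proof -
  from convergent_prod_LIMSEQ[OF convergent_prod_qpoch[OF q, of x]] have "(\<lambda>n. qpoch x q (Suc n)) \<longlonglongrightarrow> qpoch_inf x q"
    by (simp add: qpoch_def qpoch_inf_def lessThan_Suc_atMost)
  then show ?thesis by (rule LIMSEQ_imp_Suc)
qed

lemma qpoch_inf_self_nonzero:
  assumes q: "norm q < 1"
  shows "qpoch_inf q q \<noteq> 0"
  unfolding qpoch_inf_def
  by (rule prodinf_nonzero[OF convergent_prod_qpoch[OF q]])
    (use one_minus_power_nonzero[OF q, of "Suc _"] in auto)

lemma inverse_qpoch_LIMSEQ:
  "norm q < 1 \<Longrightarrow> (\<lambda>n. 1 / qpoch q q n) \<longlonglongrightarrow> 1 / qpoch_inf q q"
  by (intro tendsto_intros qpoch_LIMSEQ qpoch_inf_self_nonzero)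

lemma inverse_qpoch_bounded:
  assumes "norm q < 1"
  obtains B where "B > 0" "\<And>n. norm (1 / qpoch q q n) \<le> B"
  using convergent_imp_Bseq[OF convergentI[OF inverse_qpoch_LIMSEQ[OF assms]]]
  by (auto simp: Bseq_def)

text \<open>Tannery's theorem with majorant \<open>norm (c k) * B\<close>. The limit
  \<open>g\<close> is the same for every \<open>k\<close>, so it factors out of the series.\<close>

lemma tendsto_sum_atMost_weighted:
  fixes c :: "nat \<Rightarrow> complex"
  assumes c: "summable (\<lambda>k. norm (c k))"
    and f: "\<And>k. (\<lambda>L. f L k) \<longlonglongrightarrow> g"
    and B: "\<And>L k. k \<le> L \<Longrightarrow> norm (f L k) \<le> B"
  shows "(\<lambda>L. \<Sum>k\<le>L. c k * f L k) \<longlonglongrightarrow> suminf c * g"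
proof -
  \<comment> \<open>Extension by 0 beyond \<open>L\<close> turns the finite sums into series over a
    fixed index set.\<close>
  define a where "a k L = (if k \<le> L then c k * f L k else 0)" for k L
  have "0 \<le> B" using B[of 0 0] norm_ge_zero order_trans by blast
  have "(\<lambda>L. \<Sum>k. a k L) \<longlonglongrightarrow> (\<Sum>k. c k * g)"
  proof (rule conjunct2[OF conjunct2[OF tannerys_theorem]])
    fix k
    have "(\<lambda>L. c k * f L k) \<longlonglongrightarrow> c k * g" by (intro tendsto_intros f)
    then show "(\<lambda>L. a k L) \<longlonglongrightarrow> c k * g"
      by (rule Lim_transform_eventually)
        (use eventually_ge_at_top[of k] in \<open>eventually_elim, simp add: a_def\<close>)
  next
    have "norm (a k L) \<le> norm (c k) * B" for k L
      using B[of k L] \<open>0 \<le> B\<close> by (auto simp: a_def norm_mult intro!: mult_left_mono)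
    then show "\<forall>\<^sub>F (k, n) in sequentially \<times>\<^sub>F sequentially. norm (a k n) \<le> norm (c k) * B"
      by (intro always_eventually) auto
    show "summable (\<lambda>k. norm (c k) * B)" using c by (rule summable_mult2)
  qed simp
  moreover have "(\<Sum>k. a k L) = (\<Sum>k\<le>L. c k * f L k)" for L
    by (subst suminf_finite[of "{..L}"]) (auto simp: a_def)
  moreover have "(\<Sum>k. c k * g) = suminf c * g"
    by (rule suminf_mult2[symmetric, OF summable_norm_cancel[OF c]])
  ultimately show ?thesis by simp
qed

lemma summable_norm_power_mult:
  fixes q :: complex
  assumes q: "norm q < 1" and e: "\<And>n. n \<le> e n" and f: "\<And>n. norm (f n) \<le> B"
  shows "summable (\<lambda>n. norm (q ^ e n * f n))"
proof (rule summable_comparison_test')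
  show "summable (\<lambda>n. norm q ^ n * B)"
    using q by (intro summable_mult2 summable_geometric) simp
  show "norm (norm (q ^ e n * f n)) \<le> norm q ^ n * B" for n
    using q f by (auto simp: norm_mult norm_power intro!: mult_mono power_decreasing e)
qed

text \<open>Both sides satisfy the same recursion in \<open>d\<close>, which raises \<open>c\<close>
  by one; hence \<open>c\<close> varies in the induction. For \<open>d = 0\<close> this is Cauchy's
  identity, the limit \<open>m\<close> to infinity of the q-Chu-Vandermonde sum.\<close>

lemma qpoch_sums_q_binomial:
  assumes q: "norm q < 1"
  shows "(\<lambda>n. q ^ (n * (n + c)) / (qpoch q q n * qpoch q q (n + c + d))) sums
           (1 / qpoch_inf q q * (\<Sum>k\<le>d. qbin q d k * q ^ (k * (k + c))))"
proof (induction d arbitrary: c)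
  case 0
  let ?c = "\<lambda>s. q ^ (s * (s + c)) / (qpoch q q s * qpoch q q (s + c))"
  obtain B where B: "B > 0" "\<And>n. norm (1 / qpoch q q n) \<le> B"
    using inverse_qpoch_bounded[OF q] by blast
  obtain D where D: "D > 0" "\<And>n. norm (qpoch q q n) \<le> D"
    using convergent_imp_Bseq[OF convergentI[OF qpoch_LIMSEQ[OF q]]] by (auto simp: Bseq_def)
  have "summable (\<lambda>s. norm (q ^ (s * (s + c)) * (1 / qpoch q q s * (1 / qpoch q q (s + c)))))"
  proof (rule summable_norm_power_mult[OF q])
    show "n \<le> n * (n + c)" for n by (cases n) auto
    show "norm (1 / qpoch q q n * (1 / qpoch q q (n + c))) \<le> B * B" for n
      unfolding norm_mult using B by (intro mult_mono) (auto intro: less_imp_le)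
  qed
  then have summ: "summable (\<lambda>s. norm (?c s))" by simp
  \<comment> \<open>The part of \<open>qbin q m s\<close> that depends on \<open>m\<close> tends to
    1 for fixed \<open>s\<close>.\<close>
  have "(\<lambda>m. \<Sum>s\<le>m. ?c s * (qpoch q q m * (1 / qpoch q q (m - s)))) \<longlonglongrightarrow>
          suminf ?c * (qpoch_inf q q * (1 / qpoch_inf q q))"
  proof (rule tendsto_sum_atMost_weighted[OF summ])
    show "(\<lambda>m. qpoch q q m * (1 / qpoch q q (m - s))) \<longlonglongrightarrow> qpoch_inf q q * (1 / qpoch_inf q q)" for s
      by (intro tendsto_mult qpoch_LIMSEQ q filterlim_compose[OF inverse_qpoch_LIMSEQ[OF q]]
          filterlim_minus_const_nat_at_top)
    show "norm (qpoch q q m * (1 / qpoch q q (m - s))) \<le> D * B" for m s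
      unfolding norm_mult using B D by (intro mult_mono) (auto intro: less_imp_le)
  qed
  moreover have "(\<Sum>s\<le>m. ?c s * (qpoch q q m * (1 / qpoch q q (m - s)))) = 1 / qpoch q q (m + c)" for m
    unfolding q_Chu_Vandermonde[OF q, symmetric] by (intro sum.cong) (auto simp: qbin_def mult_ac)
  moreover have "(\<lambda>m. 1 / qpoch q q (m + c)) \<longlonglongrightarrow> 1 / qpoch_inf q q"
    using inverse_qpoch_LIMSEQ[OF q] by (rule LIMSEQ_ignore_initial_segment)
  ultimately have "suminf ?c = 1 / qpoch_inf q q"
    using qpoch_inf_self_nonzero[OF q] by (auto intro: LIMSEQ_unique)
  moreover have "summable ?c" using summ by (rule summable_norm_cancel)
  ultimately show ?case by (simp add: qbin_0_right q sums_iff)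
next
  case (Suc d)
  let ?P = "qpoch q q"
  \<comment> \<open>Uses \<open>1 / (1 - y) = 1 + y / (1 - y)\<close> with
    \<open>y = q ^ (n + c + d + 1)\<close>, the exponent of the last factor of the longer
    symbol.\<close>
  have "q ^ (n * (n + c)) / (?P n * ?P (n + c + Suc d)) =
      q ^ (n * (n + c)) / (?P n * ?P (n + c + d)) +
      q ^ (c + Suc d) * (q ^ (n * (n + Suc c)) / (?P n * ?P (n + Suc c + d)))" for n
  proof -
    have "?P n \<noteq> 0" "?P (n + c + d) \<noteq> 0" "1 - q * q ^ (n + c + d) \<noteq> 0"
      using qpoch_self_nonzero[OF q] one_minus_power_nonzero[OF q, of "Suc _"] by auto
    moreover have "q ^ (c + Suc d) * q ^ (n * (n + Suc c)) = q ^ (n * (n + c)) * (q * q ^ (n + c + d))"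
      by (simp add: algebra_simps flip: power_add power_Suc)
    moreover have "A / (p * (r * (1 - y))) = A / (p * r) + x * (X / (p * (r * (1 - y))))"
      if "p \<noteq> 0" "r \<noteq> 0" "1 - y \<noteq> 0" "x * X = A * y" for A p r y x X :: complex
      using that by (simp add: divide_simps) (simp add: algebra_simps)
    ultimately show ?thesis
      by (simp only: add_Suc_right add_Suc qpoch_Suc)
  qed
  \<comment> \<open>The finite side obeys the same recursion, by the second q-Pascal rule.\<close>
  moreover have "(\<Sum>k\<le>Suc d. qbin q (Suc d) k * q ^ (k * (k + c))) =
      (\<Sum>k\<le>d. qbin q d k * q ^ (k * (k + c))) +
      q ^ (c + Suc d) * (\<Sum>k\<le>d. qbin q d k * q ^ (k * (k + Suc c)))"
    unfolding qbin_sum_Suc(2)[OF q] sum_distrib_left sum.distrib[symmetric]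
  proof (rule sum.cong[OF refl])
    fix k assume "k \<in> {..d}"
    then have "d - k + Suc k * (Suc k + c) = (c + Suc d) + k * (k + Suc c)"
      by (simp add: algebra_simps)
    then have "q ^ (d - k) * q ^ (Suc k * (Suc k + c)) = q ^ (c + Suc d) * q ^ (k * (k + Suc c))"
      by (metis power_add)
    then show "qbin q d k * (q ^ (k * (k + c)) + q ^ (d - k) * q ^ (Suc k * (Suc k + c))) =
         qbin q d k * q ^ (k * (k + c)) + q ^ (c + Suc d) * (qbin q d k * q ^ (k * (k + Suc c)))"
      by (simp only: distrib_left mult.left_commute)
  qed
  ultimately show ?case
    using sums_add[OF Suc.IH[of c] sums_mult[OF Suc.IH[of "Suc c"], of "q ^ (c + Suc d)"]]
    by (simp only: distrib_left mult.left_commute)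
qed

text \<open>The base \<open>p\<close> is separate from the coefficients \<open>c\<close>, so that
  one theta series can be treated both in base \<open>q\<close> and in base
  \<open>q ^ 7\<close>.\<close>

lemma tendsto_theta_sum:
  assumes p: "norm p < 1" and c: "summable (\<lambda>k. norm (c k))"
  shows "(\<lambda>L. \<Sum>k\<le>L. c k / (qpoch p p (L - k) * qpoch p p (L + k))) \<longlonglongrightarrow> suminf c / (qpoch_inf p p)\<^sup>2"
proof -
  obtain B where B: "B > 0" "\<And>n. norm (1 / qpoch p p n) \<le> B"
    using inverse_qpoch_bounded[OF p] by blast
  have "(\<lambda>L. \<Sum>k\<le>L. c k * (1 / qpoch p p (L - k) * (1 / qpoch p p (L + k)))) \<longlonglongrightarrow>
      suminf c * (1 / qpoch_inf p p * (1 / qpoch_inf p p))"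
  proof (rule tendsto_sum_atMost_weighted[OF c])
    show "(\<lambda>L. 1 / qpoch p p (L - k) * (1 / qpoch p p (L + k))) \<longlonglongrightarrow>
        1 / qpoch_inf p p * (1 / qpoch_inf p p)" for k
      by (intro tendsto_mult filterlim_compose[OF inverse_qpoch_LIMSEQ[OF p]]
          filterlim_minus_const_nat_at_top filterlim_add_const_nat_at_top)
    show "norm (1 / qpoch p p (L - k) * (1 / qpoch p p (L + k))) \<le> B * B" for L k
      unfolding norm_mult using B by (intro mult_mono) (auto intro: less_imp_le)
  qed
  then show ?thesis by (simp add: power2_eq_square)
qed

text \<open>The finite identity tends in base \<open>q\<close> to an equation between the double
  series and the theta sum \<open>T\<close>; the finite triple product in base \<open>q ^ 7\<close>
  then evaluates \<open>T\<close>.\<close>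

lemma Andrews_Gordon_7:
  assumes q: "norm q < 1" "q \<noteq> 0"
  shows "(\<Sum>N. q ^ N\<^sup>2 * (\<Sum>r\<le>N. q ^ r\<^sup>2 / (qpoch q q r * qpoch q q (N - r)))) =
    qpoch_inf (q ^ 3) (q ^ 7) * qpoch_inf (q ^ 4) (q ^ 7) * qpoch_inf (q ^ 7) (q ^ 7) / qpoch_inf q q"
proof -
  define S where "S N = (\<Sum>r\<le>N. q ^ r\<^sup>2 / (qpoch q q r * qpoch q q (N - r)))" for N
  define \<theta> where "\<theta> = theta_coeff (q ^ 7) (q ^ 3) (q ^ 4)"
  define T where "T = suminf \<theta>"
  have q7: "norm (q ^ 7) < 1" using q by (simp add: norm_power power_less_one_iff)
  obtain B where B: "B > 0" "\<And>n. norm (1 / qpoch q q n) \<le> B"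
    using inverse_qpoch_bounded[OF q(1)] by blast
  have le: "n \<le> n\<^sup>2" for n :: nat by (simp add: power2_nat_le_imp_le)
  \<comment> \<open>The theta coefficients with a power of \<open>q\<close> of exponent at least
    \<open>k\<close> pulled out; the remaining factor is bounded by 2.\<close>
  have "summable (\<lambda>k. norm (q ^ (3 * k + 7 * (k choose 2)) *
      (if k = 0 then 1 else (- 1) ^ k * (1 + q ^ k))))"
  proof (rule summable_norm_power_mult[OF q(1)])
    fix k
    have "norm (1 + q ^ k) \<le> 1 + 1"
      by (rule order_trans[OF norm_triangle_ineq add_mono]) (use q in \<open>auto simp: norm_power power_le_one\<close>)
    then show "norm (if k = 0 then 1 else (- 1) ^ k * (1 + q ^ k)) \<le> 2"
      by (auto simp: norm_mult norm_power)
  qed simp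
  moreover have "q ^ (3 * k + 7 * (k choose 2)) * (if k = 0 then 1 else (- 1) ^ k * (1 + q ^ k)) = \<theta> k" for k
  proof -
    have "(q ^ 4) ^ k = (q ^ 3) ^ k * q ^ k" by (simp flip: power_mult power_add)
    moreover have "q ^ (3 * k + 7 * (k choose 2)) = (q ^ 3) ^ k * (q ^ 7) ^ (k choose 2)"
      by (simp add: power_add power_mult)
    ultimately show ?thesis
      by (simp add: \<theta>_def theta_coeff_def numeral_2_eq_2 algebra_simps del: power_mult)
  qed
  ultimately have \<theta>: "summable (\<lambda>k. norm (\<theta> k))" by simp
  \<comment> \<open>A bound uniform in \<open>N\<close>, so that the outer power of \<open>q\<close>
    alone gives summability.\<close>
  have "norm (S N) \<le> B * B * (1 / (1 - norm q))" for N
  proof -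
    have "norm (S N) \<le> (\<Sum>r\<le>N. B * B * norm q ^ r)"
      unfolding S_def
    proof (rule sum_norm_le)
      fix r
      have "norm (q ^ r\<^sup>2 * (1 / qpoch q q r * (1 / qpoch q q (N - r)))) \<le> norm q ^ r * (B * B)"
        unfolding norm_mult norm_power using q B le
        by (intro mult_mono power_decreasing) (auto intro: less_imp_le)
      then show "norm (q ^ r\<^sup>2 / (qpoch q q r * qpoch q q (N - r))) \<le> B * B * norm q ^ r"
        by (simp add: mult_ac)
    qed
    also have "\<dots> = B * B * (\<Sum>r\<le>N. norm q ^ r)" by (simp add: sum_distrib_left)
    also have "(\<Sum>r\<le>N. norm q ^ r) \<le> (\<Sum>r. norm q ^ r)"
      using q by (intro sum_le_suminf summable_geometric) auto
    also have "\<dots> = 1 / (1 - norm q)" using q by (intro suminf_geometric) auto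
    finally show ?thesis using B by simp
  qed
  then have S: "summable (\<lambda>N. norm (q ^ N\<^sup>2 * S N))"
    by (intro summable_norm_power_mult q le)
  have "(\<lambda>L. \<Sum>N\<le>L. q ^ N\<^sup>2 * S N * (1 / qpoch q q (L - N))) \<longlonglongrightarrow>
      (\<Sum>N. q ^ N\<^sup>2 * S N) * (1 / qpoch_inf q q)"
    by (rule tendsto_sum_atMost_weighted[OF S filterlim_compose[OF inverse_qpoch_LIMSEQ[OF q(1)]
          filterlim_minus_const_nat_at_top] B(2)])
  moreover have "(\<Sum>N\<le>L. q ^ N\<^sup>2 * S N * (1 / qpoch q q (L - N))) =
      (\<Sum>k\<le>L. \<theta> k / (qpoch q q (L - k) * qpoch q q (L + k)))" for L
    using finite_Andrews_Gordon_7[OF q] by (simp add: S_def \<theta>_def)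
  ultimately have "(\<Sum>N. q ^ N\<^sup>2 * S N) * (1 / qpoch_inf q q) = T / (qpoch_inf q q)\<^sup>2"
    using tendsto_theta_sum[OF q(1) \<theta>] unfolding T_def by (auto intro: LIMSEQ_unique)
  then have "(\<Sum>N. q ^ N\<^sup>2 * S N) = T / qpoch_inf q q"
    using qpoch_inf_self_nonzero[OF q(1)] by (auto simp: power2_eq_square divide_simps)
  moreover have "T = qpoch_inf (q ^ 3) (q ^ 7) * qpoch_inf (q ^ 4) (q ^ 7) * qpoch_inf (q ^ 7) (q ^ 7)"
  proof -
    have "(\<Sum>k\<le>L. \<theta> k / (qpoch (q^7) (q^7) (L - k) * qpoch (q^7) (q^7) (L + k))) =
        qpoch (q ^ 3) (q ^ 7) L * qpoch (q ^ 4) (q ^ 7) L / qpoch (q ^ 7) (q ^ 7) (2 * L)" for L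
      unfolding \<theta>_def using q q7 by (intro finite_Jacobi_triple_product) (auto simp flip: power_add)
    moreover have "filterlim (\<lambda>L::nat. 2 * L) at_top sequentially"
      by (intro filterlim_subseq) (auto simp: strict_mono_def)
    then have "(\<lambda>L. qpoch (q ^ 3) (q ^ 7) L * qpoch (q ^ 4) (q ^ 7) L / qpoch (q ^ 7) (q ^ 7) (2 * L)) \<longlonglongrightarrow>
        qpoch_inf (q ^ 3) (q ^ 7) * qpoch_inf (q ^ 4) (q ^ 7) / qpoch_inf (q ^ 7) (q ^ 7)"
      by (intro tendsto_intros qpoch_LIMSEQ q7 qpoch_inf_self_nonzero filterlim_compose[OF qpoch_LIMSEQ])
    ultimately have "T / (qpoch_inf (q ^ 7) (q ^ 7))\<^sup>2 =
        qpoch_inf (q ^ 3) (q ^ 7) * qpoch_inf (q ^ 4) (q ^ 7) / qpoch_inf (q ^ 7) (q ^ 7)"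
      using tendsto_theta_sum[OF q7 \<theta>] unfolding T_def by (auto intro: LIMSEQ_unique)
    then show ?thesis
      using qpoch_inf_self_nonzero[OF q7] by (simp add: power2_eq_square divide_simps)
  qed
  ultimately show ?thesis by (simp add: S_def)
qed

section \<open>The product over residue classes modulo 7\<close>

text \<open>Sorting the factors of \<open>qpoch q q (7 * L)\<close> by residue modulo 7 gives
  classes 3, 4 and 0 as q-Pochhammer symbols in base \<open>q ^ 7\<close>; the rest is the
  reciprocal of the wanted product. Then \<open>L\<close> tends to infinity.\<close>

lemma prodinf_not_0_3_mod_7:
  assumes q: "norm q < 1"
  shows "(\<Prod>m :: nat.
                 if 1 \<le> m \<and> \<not> [int m = 0] (mod 7) \<and>
                    \<not> [int m = 3] (mod 7) \<and> \<not> [int m = - 3] (mod 7)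
                 then 1 / (1 - q ^ m) else 1) =
    qpoch_inf (q ^ 3) (q ^ 7) * qpoch_inf (q ^ 4) (q ^ 7) * qpoch_inf (q ^ 7) (q ^ 7) / qpoch_inf q q"
proof -
  define h where "h m = (if m mod 7 \<in> {1, 2, 5, 6} then 1 - q ^ m else 1)" for m
  have q7: "norm (q ^ 7) < 1" using q by (simp add: norm_power power_less_one_iff)
  have iff: "(1 \<le> m \<and> \<not> [int m = 0] (mod 7) \<and> \<not> [int m = 3] (mod 7) \<and> \<not> [int m = - 3] (mod 7))
      \<longleftrightarrow> m mod 7 \<in> {1, 2, 5, 6}" for m :: nat
  proof -
    have "m mod 7 \<in> {0, 1, 2, 3, 4, 5, 6}" by auto
    moreover have "int m mod 7 = int (m mod 7)" by (simp add: zmod_int)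
    ultimately show ?thesis by (cases "m = 0") (auto simp: cong_def)
  qed
  have conv: "convergent_prod h"
  proof -
    have "summable (\<lambda>m. norm (h m - 1))"
      by (rule summable_comparison_test'[OF summable_geometric[of "norm q"]])
        (use q in \<open>auto simp: h_def norm_power\<close>)
    then show ?thesis
      by (intro abs_convergent_prod_imp_convergent_prod) (simp add: abs_convergent_prod_conv_summable)
  qed
  have "prodinf h * (qpoch_inf (q ^ 3) (q ^ 7) * qpoch_inf (q ^ 4) (q ^ 7) * qpoch_inf (q ^ 7) (q ^ 7)) =
      qpoch_inf q q"
  proof -
    have "(\<Prod>m\<le>7 * L. h m) * (qpoch (q ^ 3) (q ^ 7) L * qpoch (q ^ 4) (q ^ 7) L * qpoch (q ^ 7) (q ^ 7) L) =
        qpoch q q (7 * L)" for L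
    proof (induction L)
      case (Suc L)
      have res: "(7 * L + k) mod 7 = k mod 7" for k by simp
      have "(\<Prod>m\<le>n + 7. h m) = (\<Prod>m\<le>n. h m) *
          (h (n + 1) * h (n + 2) * h (n + 3) * h (n + 4) * h (n + 5) * h (n + 6) * h (n + 7))" for n
        by (simp add: numeral_eq_Suc mult.assoc)
      from this[of "7 * L"] have "(\<Prod>m\<le>7 * L + 7. h m) = (\<Prod>m\<le>7 * L. h m) *
          ((1 - q ^ (7 * L + 1)) * (1 - q ^ (7 * L + 2)) * (1 - q ^ (7 * L + 5)) * (1 - q ^ (7 * L + 6)))"
        unfolding h_def res by (simp add: mult.assoc)
      moreover have "qpoch q q (n + 7) = qpoch q q n * ((1 - q ^ (n + 1)) * (1 - q ^ (n + 2)) *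
          (1 - q ^ (n + 3)) * (1 - q ^ (n + 4)) * (1 - q ^ (n + 5)) * (1 - q ^ (n + 6)) * (1 - q ^ (n + 7)))" for n
        by (simp add: numeral_eq_Suc qpoch_Suc mult.assoc)
      moreover have "q ^ k * (q ^ 7) ^ L = q ^ (7 * L + k)" for k
        by (simp add: power_add flip: power_mult)
      ultimately show ?case
        unfolding mult_Suc_right add.commute[of 7 "7 * L"] qpoch_Suc
        by (simp only: Suc.IH[symmetric]) (simp only: mult_ac)
    qed (simp add: h_def)
    moreover have sub: "filterlim (\<lambda>L::nat. 7 * L) at_top sequentially"
      by (intro filterlim_subseq) (auto simp: strict_mono_def)
    ultimately have "(\<lambda>L. (\<Prod>m\<le>7 * L. h m) * (qpoch (q ^ 3) (q ^ 7) L * qpoch (q ^ 4) (q ^ 7) L * qpoch (q ^ 7) (q ^ 7) L)) \<longlonglongrightarrow> qpoch_inf q q"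
      by (simp add: filterlim_compose[OF qpoch_LIMSEQ[OF q]])
    moreover have "(\<lambda>L. (\<Prod>m\<le>7 * L. h m) * (qpoch (q ^ 3) (q ^ 7) L * qpoch (q ^ 4) (q ^ 7) L * qpoch (q ^ 7) (q ^ 7) L)) \<longlonglongrightarrow>
        prodinf h * (qpoch_inf (q ^ 3) (q ^ 7) * qpoch_inf (q ^ 4) (q ^ 7) * qpoch_inf (q ^ 7) (q ^ 7))"
      by (intro tendsto_mult qpoch_LIMSEQ q7 filterlim_compose[OF convergent_prod_LIMSEQ[OF conv] sub])
    ultimately show ?thesis by (rule LIMSEQ_unique[symmetric])
  qed
  \<comment> \<open>The nonvanishing of \<open>prodinf h\<close> comes for free from that of
    \<open>qpoch_inf q q\<close>.\<close>
  moreover have "inverse a = x / p" if "a * x = p" "p \<noteq> 0" for a x p :: complex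
    using that by (auto simp: field_simps)
  ultimately have "inverse (prodinf h) =
     qpoch_inf (q ^ 3) (q ^ 7) * qpoch_inf (q ^ 4) (q ^ 7) * qpoch_inf (q ^ 7) (q ^ 7) / qpoch_inf q q"
    using qpoch_inf_self_nonzero[OF q] by blast
  moreover have "(\<Prod>m. if 1 \<le> m \<and> \<not> [int m = 0] (mod 7) \<and>
       \<not> [int m = 3] (mod 7) \<and> \<not> [int m = - 3] (mod 7) then 1 / (1 - q ^ m) else 1) =
     (\<Prod>m. inverse (h m))"
    unfolding iff by (intro prodinf_cong) (simp add: h_def divide_inverse)
  ultimately show ?thesis using prodinf_inverse[OF conv] by simp
qed

section \<open>The double series\<close>

text \<open>Domination by a product of two geometric series. Summability over all pairs is what
  permits summing over \<open>n\<close> first.\<close>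

lemma double_sum_summable:
  assumes q: "norm q < 1"
  shows "(\<lambda>(n, l). q ^ (n\<^sup>2 + l\<^sup>2) / (qpoch q q (n + l) * qpoch q q n * qpoch q q l)) summable_on UNIV"
proof -
  obtain B where B: "B > 0" "\<And>n. norm (1 / qpoch q q n) \<le> B"
    using inverse_qpoch_bounded[OF q] by blast
  have geo: "(\<lambda>n. norm q ^ n) summable_on UNIV"
    using q by (intro norm_summable_imp_summable_on) (simp add: summable_geometric norm_power)
  have "(\<lambda>(n, l). norm q ^ n * norm q ^ l) summable_on UNIV \<times> UNIV"
  proof (rule summable_on_SigmaI)
    show "((\<lambda>l. case (n, l) of (n, l) \<Rightarrow> norm q ^ n * norm q ^ l) has_sum
        (norm q ^ n * infsum (\<lambda>l. norm q ^ l) UNIV)) UNIV" for n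
      using has_sum_cmult_right[OF has_sum_infsum[OF geo]] by simp
    show "(\<lambda>n. norm q ^ n * infsum (\<lambda>l. norm q ^ l) UNIV) summable_on UNIV"
      by (rule summable_on_cmult_left[OF geo])
  qed simp
  then have *: "(\<lambda>x. B * B * B * (case x of (n, l) \<Rightarrow> norm q ^ n * norm q ^ l)) summable_on UNIV"
    by (intro summable_on_cmult_right) simp
  show ?thesis
  proof (rule abs_summable_summable, rule summable_on_comparison_test[OF *])
    fix x :: "nat \<times> nat"
    obtain n l where x: "x = (n, l)" by force
    have le: "k \<le> k\<^sup>2" for k :: nat by (simp add: power2_nat_le_imp_le)
    have "norm (q ^ n\<^sup>2 * q ^ l\<^sup>2 * (1 / qpoch q q (n + l) * (1 / qpoch q q n) * (1 / qpoch q q l)))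
        \<le> norm q ^ n * norm q ^ l * (B * B * B)"
      unfolding norm_mult norm_power using q B le
      by (intro mult_mono power_decreasing) (auto intro!: less_imp_le)
    then show "norm (case x of (n, l) \<Rightarrow> q ^ (n\<^sup>2 + l\<^sup>2) / (qpoch q q (n + l) * qpoch q q n * qpoch q q l))
        \<le> B * B * B * (case x of (n, l) \<Rightarrow> norm q ^ n * norm q ^ l)"
      by (simp add: x power_add mult_ac)
  qed auto
qed

text \<open>Only the pair \<open>(0, 0)\<close> contributes, as \<open>0 ^ 0 = 1\<close>. The value
  \<open>q = 0\<close> is treated apart because the finite triple product divides by powers of
  \<open>q\<close>.\<close>

lemma double_sum_0:
  "((\<lambda>(n, l). 0 ^ (n\<^sup>2 + l\<^sup>2) / (qpoch 0 0 (n + l) * qpoch 0 0 n * qpoch 0 0 l)) has_sum 1) UNIV"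
  by (rule has_sum_finite_neutralI[where B = "{(0, 0)}"]) auto

theorem mainTheorem9:
  fixes q :: complex
  assumes "norm q < 1"
  shows "((\<lambda>(n :: nat, l :: nat).
             q ^ (n\<^sup>2 + l\<^sup>2) / (qpoch q q (n + l) * qpoch q q n * qpoch q q l))
          has_sum
            (1 / qpoch_inf q q *
              (\<Prod>m :: nat.
                 if 1 \<le> m \<and> \<not> [int m = 0] (mod 7) \<and>
                    \<not> [int m = 3] (mod 7) \<and> \<not> [int m = - 3] (mod 7)
                 then 1 / (1 - q ^ m) else 1)))
         UNIV"
proof (cases "q = 0")
  case True
  have "qpoch_inf 0 0 = 1" "qpoch_inf (0 ^ 3) (0 ^ 7) = 1" "qpoch_inf (0 ^ 4) (0 ^ 7) = 1"
    "qpoch_inf (0 ^ 7) (0 ^ 7) = 1"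
    by (simp_all add: qpoch_inf_def)
  then show ?thesis
    unfolding prodinf_not_0_3_mod_7[OF assms] using double_sum_0 by (simp add: True)
next
  case False
  let ?P = "qpoch q q"
  \<comment> \<open>The coordinates are swapped so that the inner sum of the iterated summation runs
    over \<open>n\<close>.\<close>
  define f where "f = (\<lambda>(l, n). q ^ (n\<^sup>2 + l\<^sup>2) / (?P (n + l) * ?P n * ?P l))"
  define S where "S l = (\<Sum>k\<le>l. q ^ k\<^sup>2 / (?P k * ?P (l - k)))" for l
  have "(\<lambda>(n, l). q ^ (n\<^sup>2 + l\<^sup>2) / (?P (n + l) * ?P n * ?P l)) summable_on UNIV \<times> UNIV"
    using double_sum_summable[OF assms] by simp
  then have "f summable_on UNIV \<times> UNIV"
    unfolding f_def by (subst (asm) summable_on_swap) simp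
  then have f: "(f has_sum infsum f (UNIV \<times> UNIV)) (UNIV \<times> UNIV)" by simp
  have inner: "((\<lambda>n. f (l, n)) has_sum (1 / qpoch_inf q q * (q ^ l\<^sup>2 * S l))) UNIV" for l
  proof -
    have "(\<lambda>n. f (l, n)) summable_on UNIV"
      using \<open>f summable_on UNIV \<times> UNIV\<close> summable_on_SigmaD1[of "\<lambda>l n. f (l, n)" UNIV "\<lambda>_. UNIV" l] by simp
    then obtain s where s: "((\<lambda>n. f (l, n)) has_sum s) UNIV" by (auto simp: summable_on_def)
    \<comment> \<open>The terminating transformation at \<open>c = 0\<close> and
      \<open>d = l\<close>; the factor \<open>?P l\<close> it produces cancels against
      \<open>1 / ?P l\<close>.\<close>
    have "(\<lambda>n. q ^ l\<^sup>2 / ?P l * (q ^ (n * (n + 0)) / (?P n * ?P (n + 0 + l)))) sums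
        (q ^ l\<^sup>2 / ?P l * (1 / qpoch_inf q q * (\<Sum>k\<le>l. qbin q l k * q ^ (k * (k + 0)))))"
      by (intro sums_mult qpoch_sums_q_binomial assms)
    also have "(\<lambda>n. q ^ l\<^sup>2 / ?P l * (q ^ (n * (n + 0)) / (?P n * ?P (n + 0 + l)))) = (\<lambda>n. f (l, n))"
      by (simp add: f_def fun_eq_iff power_add power2_eq_square mult_ac)
    also have "(\<Sum>k\<le>l. qbin q l k * q ^ (k * (k + 0))) = ?P l * S l"
      by (simp add: S_def sum_distrib_left qbin_def power2_eq_square)
    finally have "(\<lambda>n. f (l, n)) sums (1 / qpoch_inf q q * (q ^ l\<^sup>2 * S l))"
      using qpoch_self_nonzero[OF assms, of l] by simp
    \<comment> \<open>Summability supplies some unconditional sum \<open>s\<close>; uniqueness of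
      the sum of the ordinary series identifies it.\<close>
    then show ?thesis
      using s has_sum_imp_sums sums_unique2 by metis
  qed
  have outer: "((\<lambda>l. 1 / qpoch_inf q q * (q ^ l\<^sup>2 * S l)) has_sum infsum f (UNIV \<times> UNIV)) UNIV"
    by (rule has_sum_SigmaD[OF f inner])
  then have "(\<lambda>l. 1 / qpoch_inf q q * (q ^ l\<^sup>2 * S l)) sums infsum f (UNIV \<times> UNIV)"
    by (rule has_sum_imp_sums)
  then have "(\<lambda>l. qpoch_inf q q * (1 / qpoch_inf q q * (q ^ l\<^sup>2 * S l))) sums
      (qpoch_inf q q * infsum f (UNIV \<times> UNIV))"
    by (rule sums_mult)
  then have "(\<Sum>l. q ^ l\<^sup>2 * S l) = qpoch_inf q q * infsum f (UNIV \<times> UNIV)"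
    using qpoch_inf_self_nonzero[OF assms] by (simp add: sums_iff)
  then have "infsum f (UNIV \<times> UNIV) = 1 / qpoch_inf q q * (\<Sum>l. q ^ l\<^sup>2 * S l)"
    using qpoch_inf_self_nonzero[OF assms] by simp
  then have val: "infsum f (UNIV \<times> UNIV) = 1 / qpoch_inf q q *
     (qpoch_inf (q ^ 3) (q ^ 7) * qpoch_inf (q ^ 4) (q ^ 7) * qpoch_inf (q ^ 7) (q ^ 7) / qpoch_inf q q)"
    unfolding S_def Andrews_Gordon_7[OF assms False] .
  show ?thesis
    using f unfolding prodinf_not_0_3_mod_7[OF assms] val[symmetric]
    by (subst (asm) has_sum_swap) (simp add: f_def)
qed

end
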